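(* Let $G$ be an ample groupoid with Hausdorff unit space, and let $A(G)$ be its complex Steinberg algebra. Suppose $\pi:A(G) \to B(\mathscr{H})$ is a $*$-homomorphism for some Hilbert space $\mathscr{H}$. Then $\pi$ is continuous with respect to the inductive limit topology on $A(G)$.
   Context: A topological groupoid $G$ (with unit space $G^{(0)}$, source $s$ and range $r$) is étale if $s$ (hence $r$) is a local homeomorphism. An open bisection is an open set $B\subseteq G$ such that $r|_B$ and $s|_B$ are homeomorphisms onto open subsets of $G^{(0)}$. $G$ is ample if it has a basis of compact open bisections; compact means every open cover has a finite subcover. $G$ itself need not be Hausdorff. The complex Steinberg algebra is $A(G)=\operatorname{span}_{\mathbb{C}}\{1_B : B\subseteq G \text{ a compact open bisection}\}$, a space of functions $G\to\mathbb{C}$. It is a $*$-algebra under convolution $f*g(\gamma)=\sum_{\alpha\beta=\gamma}f(\alpha)g(\beta)$ and involution $f^*(\gamma)=\overline{f(\gamma^{-1})}$. For a function $f$ write $\operatorname{supp}^o(f)=\{\gamma\in G: f(\gamma)\neq 0\}$. A net of functions $(f_n)$ converges to $f$ in the inductive limit topology if $f_n\to f$ uniformly and there is a compact set $K\subseteq G$ with $\operatorname{supp}^o(f_n)\subseteq K$ eventually (it is not claimed that there is a topology for which these are the only convergent nets). A map with domain $A(G)$ is continuous with respect to the inductive limit topology if it takes nets converging in the inductive limit topology to convergent nets (with the corresponding limit) in the codomain; here $B(\mathscr{H})$ carries the operator norm. $*$-homomorphisms are not assumed bounded or continuous. *)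

theory Defs
  imports "HOL-Analysis.Analysis"
begin

section \<open>Ample groupoids\<close>

text \<open>
  A topological groupoid is given by its space of arrows, with the unit space realised as the set
  of identity arrows. The operations are total functions, constrained only on arrows, and
  multiplication only on composable pairs.
\<close>

record 'g groupoid_data =
  arrow_top :: "'g topology"
  src :: "'g \<Rightarrow> 'g"
  rng :: "'g \<Rightarrow> 'g"
  gmult :: "'g \<Rightarrow> 'g \<Rightarrow> 'g"
  ginv :: "'g \<Rightarrow> 'g"

abbreviation arrows :: "'g groupoid_data \<Rightarrow> 'g set" where
  "arrows G \<equiv> topspace (arrow_top G)"

definition units :: "'g groupoid_data \<Rightarrow> 'g set" where
  "units G = src G ` arrows G"

definition unit_top :: "'g groupoid_data \<Rightarrow> 'g topology" where
  "unit_top G = subtopology (arrow_top G) (units G)"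

definition composable :: "'g groupoid_data \<Rightarrow> ('g \<times> 'g) set" where
  "composable G = {(\<alpha>, \<beta>). \<alpha> \<in> arrows G \<and> \<beta> \<in> arrows G \<and> src G \<alpha> = rng G \<beta>}"

locale groupoid =
  fixes G :: "'g groupoid_data"
  assumes src_closed: "\<alpha> \<in> arrows G \<Longrightarrow> src G \<alpha> \<in> arrows G"
    and rng_closed: "\<alpha> \<in> arrows G \<Longrightarrow> rng G \<alpha> \<in> arrows G"
    and src_src: "\<alpha> \<in> arrows G \<Longrightarrow> src G (src G \<alpha>) = src G \<alpha>"
    and rng_src: "\<alpha> \<in> arrows G \<Longrightarrow> rng G (src G \<alpha>) = src G \<alpha>"
    and src_rng: "\<alpha> \<in> arrows G \<Longrightarrow> src G (rng G \<alpha>) = rng G \<alpha>"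
    and rng_rng: "\<alpha> \<in> arrows G \<Longrightarrow> rng G (rng G \<alpha>) = rng G \<alpha>"
    and mult_closed: "(\<alpha>, \<beta>) \<in> composable G \<Longrightarrow> gmult G \<alpha> \<beta> \<in> arrows G"
    and src_mult: "(\<alpha>, \<beta>) \<in> composable G \<Longrightarrow> src G (gmult G \<alpha> \<beta>) = src G \<beta>"
    and rng_mult: "(\<alpha>, \<beta>) \<in> composable G \<Longrightarrow> rng G (gmult G \<alpha> \<beta>) = rng G \<alpha>"
    and mult_assoc: "(\<alpha>, \<beta>) \<in> composable G \<Longrightarrow> (\<beta>, \<gamma>) \<in> composable G \<Longrightarrow>
      gmult G (gmult G \<alpha> \<beta>) \<gamma> = gmult G \<alpha> (gmult G \<beta> \<gamma>)"
    and rng_mult_left: "\<alpha> \<in> arrows G \<Longrightarrow> gmult G (rng G \<alpha>) \<alpha> = \<alpha>"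
    and mult_src_right: "\<alpha> \<in> arrows G \<Longrightarrow> gmult G \<alpha> (src G \<alpha>) = \<alpha>"
    and inv_closed: "\<alpha> \<in> arrows G \<Longrightarrow> ginv G \<alpha> \<in> arrows G"
    and src_inv: "\<alpha> \<in> arrows G \<Longrightarrow> src G (ginv G \<alpha>) = rng G \<alpha>"
    and rng_inv: "\<alpha> \<in> arrows G \<Longrightarrow> rng G (ginv G \<alpha>) = src G \<alpha>"
    and inv_mult: "\<alpha> \<in> arrows G \<Longrightarrow> gmult G (ginv G \<alpha>) \<alpha> = src G \<alpha>"
    and mult_inv: "\<alpha> \<in> arrows G \<Longrightarrow> gmult G \<alpha> (ginv G \<alpha>) = rng G \<alpha>"

text \<open>Continuity of source and range follows from that of multiplication and inversion.\<close>

locale topological_groupoid = groupoid +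
  assumes continuous_mult:
      "continuous_map
         (subtopology (prod_topology (arrow_top G) (arrow_top G)) (composable G))
         (arrow_top G) (\<lambda>(\<alpha>, \<beta>). gmult G \<alpha> \<beta>)"
    and continuous_inv: "continuous_map (arrow_top G) (arrow_top G) (ginv G)"

definition local_homeomorphism :: "'a topology \<Rightarrow> 'b topology \<Rightarrow> ('a \<Rightarrow> 'b) \<Rightarrow> bool" where
  "local_homeomorphism X Y f \<longleftrightarrow>
     (\<forall>x\<in>topspace X. \<exists>U. openin X U \<and> x \<in> U \<and> openin Y (f ` U) \<and>
        homeomorphic_map (subtopology X U) (subtopology Y (f ` U)) f)"

definition etale_groupoid :: "'g groupoid_data \<Rightarrow> bool" where
  "etale_groupoid G \<longleftrightarrow>
     topological_groupoid G \<and> local_homeomorphism (arrow_top G) (unit_top G) (src G)"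

definition open_bisection :: "'g groupoid_data \<Rightarrow> 'g set \<Rightarrow> bool" where
  "open_bisection G B \<longleftrightarrow>
     openin (arrow_top G) B \<and>
     openin (unit_top G) (rng G ` B) \<and>
     homeomorphic_map (subtopology (arrow_top G) B) (subtopology (unit_top G) (rng G ` B)) (rng G) \<and>
     openin (unit_top G) (src G ` B) \<and>
     homeomorphic_map (subtopology (arrow_top G) B) (subtopology (unit_top G) (src G ` B)) (src G)"

definition compact_open_bisection :: "'g groupoid_data \<Rightarrow> 'g set \<Rightarrow> bool" where
  "compact_open_bisection G B \<longleftrightarrow> open_bisection G B \<and> compactin (arrow_top G) B"

definition ample_groupoid :: "'g groupoid_data \<Rightarrow> bool" where
  "ample_groupoid G \<longleftrightarrow>
     etale_groupoid G \<and>
     (\<forall>U \<gamma>. openin (arrow_top G) U \<and> \<gamma> \<in> U \<longrightarrow>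
        (\<exists>B. compact_open_bisection G B \<and> \<gamma> \<in> B \<and> B \<subseteq> U))"


section \<open>The complex Steinberg algebra\<close>

text \<open>Functions on the groupoid are extended by zero outside its set of arrows.\<close>

definition steinberg_algebra :: "'g groupoid_data \<Rightarrow> ('g \<Rightarrow> complex) set" where
  "steinberg_algebra G =
     {(\<lambda>\<gamma>. \<Sum>B\<in>\<B>. c B * indicator B \<gamma>) | \<B> c.
        finite \<B> \<and> (\<forall>B\<in>\<B>. compact_open_bisection G B)}"

text \<open>
  For elements of the Steinberg algebra of an ample groupoid only finitely many terms of the
  following sum are nonzero, so no question of convergence arises; \<open>infsum\<close> is used because
  \<open>sum\<close> is zero over an infinite index set.
\<close>

definition convolution ::
    "'g groupoid_data \<Rightarrow> ('g \<Rightarrow> complex) \<Rightarrow> ('g \<Rightarrow> complex) \<Rightarrow> 'g \<Rightarrow> complex" where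
  "convolution G f g \<gamma> =
     (\<Sum>\<^sub>\<infinity>(\<alpha>, \<beta>)\<in>{(\<alpha>, \<beta>). (\<alpha>, \<beta>) \<in> composable G \<and> gmult G \<alpha> \<beta> = \<gamma>}. f \<alpha> * g \<beta>)"

definition involution :: "'g groupoid_data \<Rightarrow> ('g \<Rightarrow> complex) \<Rightarrow> 'g \<Rightarrow> complex" where
  "involution G f \<gamma> = (if \<gamma> \<in> arrows G then cnj (f (ginv G \<gamma>)) else 0)"

definition osupp :: "'g groupoid_data \<Rightarrow> ('g \<Rightarrow> complex) \<Rightarrow> 'g set" where
  "osupp G f = {\<gamma> \<in> arrows G. f \<gamma> \<noteq> 0}"

text \<open>
  Nets are represented, as throughout the library, by functions on an index type together with a
  filter on that type; a net over a directed set corresponds to the filter generated by its tails.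
\<close>

definition tendsto_ind_limit ::
    "'g groupoid_data \<Rightarrow> ('i \<Rightarrow> 'g \<Rightarrow> complex) \<Rightarrow> ('g \<Rightarrow> complex) \<Rightarrow> 'i filter \<Rightarrow> bool" where
  "tendsto_ind_limit G f l F \<longleftrightarrow>
     uniform_limit (arrows G) f l F \<and>
     (\<exists>K. compactin (arrow_top G) K \<and> (\<forall>\<^sub>F i in F. osupp G (f i) \<subseteq> K))"


section \<open>Bounded operators on a complex Hilbert space\<close>

text \<open>
  The inner product is linear in the first argument. Positive definiteness and the fact that the
  norm is the one induced by the inner product are both expressed by \<open>cinner_self\<close>;
  completeness comes from \<^class>\<open>banach\<close>.
\<close>

class complex_hilbert = banach +
  fixes scaleC :: "complex \<Rightarrow> 'a \<Rightarrow> 'a" (infixr "*\<^sub>C" 75)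
    and cinner :: "'a \<Rightarrow> 'a \<Rightarrow> complex"
  assumes scaleC_add_right: "c *\<^sub>C (x + y) = c *\<^sub>C x + c *\<^sub>C y"
    and scaleC_add_left: "(c + d) *\<^sub>C x = c *\<^sub>C x + d *\<^sub>C x"
    and scaleC_scaleC: "c *\<^sub>C d *\<^sub>C x = (c * d) *\<^sub>C x"
    and scaleC_of_real: "complex_of_real r *\<^sub>C x = r *\<^sub>R x"
    and cinner_add_left: "cinner (x + y) z = cinner x z + cinner y z"
    and cinner_scaleC_left: "cinner (c *\<^sub>C x) y = c * cinner x y"
    and cinner_commute: "cinner x y = cnj (cinner y x)"
    and cinner_self: "cinner x x = complex_of_real ((norm x)\<^sup>2)"

text \<open>
  The type of \<open>blinfun\<close>s consists of the bounded real-linear operators under the operator norm,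
  so that the bounded operators on the complex Hilbert space are its complex-linear elements.
\<close>

definition bounded_ops :: "('h::complex_hilbert \<Rightarrow>\<^sub>L 'h) set" where
  "bounded_ops = {T. \<forall>c x. blinfun_apply T (c *\<^sub>C x) = c *\<^sub>C blinfun_apply T x}"

definition is_adjoint ::
    "('h::complex_hilbert \<Rightarrow>\<^sub>L 'h) \<Rightarrow> ('h \<Rightarrow>\<^sub>L 'h) \<Rightarrow> bool" where
  "is_adjoint S T \<longleftrightarrow>
     (\<forall>x y. cinner (blinfun_apply T x) y = cinner x (blinfun_apply S y))"

definition star_homomorphism ::
    "'g groupoid_data \<Rightarrow> (('g \<Rightarrow> complex) \<Rightarrow> 'h::complex_hilbert \<Rightarrow>\<^sub>L 'h) \<Rightarrow> bool" where
  "star_homomorphism G \<pi> \<longleftrightarrow>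
     (\<forall>f\<in>steinberg_algebra G. \<pi> f \<in> bounded_ops) \<and>
     (\<forall>f\<in>steinberg_algebra G. \<forall>g\<in>steinberg_algebra G. \<pi> (\<lambda>\<gamma>. f \<gamma> + g \<gamma>) = \<pi> f + \<pi> g) \<and>
     (\<forall>f\<in>steinberg_algebra G. \<forall>c x.
        blinfun_apply (\<pi> (\<lambda>\<gamma>. c * f \<gamma>)) x = c *\<^sub>C blinfun_apply (\<pi> f) x) \<and>
     (\<forall>f\<in>steinberg_algebra G. \<forall>g\<in>steinberg_algebra G.
        \<pi> (convolution G f g) = \<pi> f o\<^sub>L \<pi> g) \<and>
     (\<forall>f\<in>steinberg_algebra G. is_adjoint (\<pi> (involution G f)) (\<pi> f))"

end

theory Submission
  imports Defs
begin

text \<open>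
  The theorem follows from a norm estimate. If the support of \<open>f\<close> is covered by \<open>n\<close> compact
  open bisections and \<open>f\<close> is bounded by \<open>M\<close>, then \<open>\<pi> f\<close> has norm at most \<open>n * M\<close>
  (\<open>norm_\<pi>_le\<close>). For a net converging in the inductive limit topology, the differences from
  the limit have their supports eventually in one compact set, so that \<open>n\<close> can be fixed while \<open>M\<close>
  tends to 0.

  For the estimate, \<open>f\<close> is written as a sum of functions bounded by \<open>M\<close>, one for
  each of the \<open>n\<close> bisections. Cutting \<open>f\<close> down to a bisection is not an option: the arrows need not
  form a Hausdorff space, and the restriction may leave the Steinberg algebra. But every bisection
  is a homeomorphic copy of part of the unit space, which is Hausdorff with a basis of
  clopen sets. Near a unit \<open>u\<close>, the function \<open>f\<close> is the sum, over the finitely many arrows \<open>\<delta>\<close> with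
  range \<open>u\<close> at which it does not vanish, of \<open>f \<delta>\<close> times the indicator of a small bisection around
  \<open>\<delta>\<close> (\<open>local_decomposition\<close>). Each such bisection can be taken inside one of the \<open>n\<close> given ones,
  and the coefficients are values of \<open>f\<close>. Finitely many of these local decompositions, over
  disjoint clopen sets of units, are patched together (\<open>decomposition\<close>).

  Each of the \<open>n\<close> summands is then a combination, with coefficients bounded by \<open>M\<close>, of indicators of
  disjoint subsets of one bisection. Such indicators are sent to partial isometries with
  orthogonal ranges and orthogonal initial spaces, so the norm of the combination is at most \<open>M\<close>
  (\<open>norm_\<pi>_step\<close>). Only the algebraic relations \<open>1\<^sub>V\<^sup>* * 1\<^sub>V = 1\<^bsub>s(V)\<^esub>\<close> and
  \<open>1\<^sub>V\<^sup>* * 1\<^sub>W = 0\<close> for disjoint \<open>V\<close>, \<open>W\<close> in one bisection enter here.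
\<close>

section \<open>Source, range and units\<close>

lemma homeomorphic_map_restrict:
  assumes "continuous_map X Y f" "open_map X Y f" "openin X B" "inj_on f B"
  shows "homeomorphic_map (subtopology X B) (subtopology Y (f ` B)) f"
proof (rule bijective_open_imp_homeomorphic_map)
  have B: "B \<subseteq> topspace X" using assms(3) openin_subset by blast
  have fB: "f ` B \<subseteq> topspace Y" 
    using assms(1) B by (auto simp: continuous_map_def)
  show "continuous_map (subtopology X B) (subtopology Y (f ` B)) f"
    using assms(1) by (auto simp: continuous_map_in_subtopology continuous_map_from_subtopology)
  have "openin Y (f ` B)" using assms(2,3) by (auto simp: open_map_def)
  then show "open_map (subtopology X B) (subtopology Y (f ` B)) f"
    using assms(2,3) unfolding open_map_def
    by (auto simp: openin_open_subtopology image_mono)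
  show "f ` topspace (subtopology X B) = topspace (subtopology Y (f ` B))"
    using B fB by (auto simp: Int_absorb1 Int_absorb2)
  show "inj_on f (topspace (subtopology X B))"
    using assms(4) by (rule inj_on_subset) auto
qed

locale hausdorff_ample_groupoid = topological_groupoid G for G :: "'g groupoid_data" +
  assumes src_local_homeomorphism: "local_homeomorphism (arrow_top G) (unit_top G) (src G)"
    and compact_open_bisection_basis:
      "openin (arrow_top G) U \<Longrightarrow> \<gamma> \<in> U \<Longrightarrow>
        \<exists>B. compact_open_bisection G B \<and> \<gamma> \<in> B \<and> B \<subseteq> U"
    and Hausdorff_unit_top: "Hausdorff_space (unit_top G)"
begin

lemma units_subset: "units G \<subseteq> arrows G"
  by (auto simp: units_def src_closed)

lemma topspace_unit_top: "topspace (unit_top G) = units G"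
  using units_subset by (auto simp: unit_top_def)

lemma src_in_units: "\<alpha> \<in> arrows G \<Longrightarrow> src G \<alpha> \<in> units G"
  by (auto simp: units_def)

lemma rng_eq_src_inv: "\<alpha> \<in> arrows G \<Longrightarrow> rng G \<alpha> = src G (ginv G \<alpha>)"
  by (simp add: src_inv)

lemma rng_in_units: "\<alpha> \<in> arrows G \<Longrightarrow> rng G \<alpha> \<in> units G"
  by (simp add: rng_eq_src_inv src_in_units inv_closed)

lemma src_unit: "u \<in> units G \<Longrightarrow> src G u = u"
  by (auto simp: units_def src_src)

lemma rng_unit: "u \<in> units G \<Longrightarrow> rng G u = u"
  by (auto simp: units_def rng_src)

lemma inv_mult_cancel:
  assumes "(\<alpha>, \<beta>) \<in> composable G"
  shows "gmult G (ginv G \<alpha>) (gmult G \<alpha> \<beta>) = \<beta>"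
proof -
  have ab: "\<alpha> \<in> arrows G" "\<beta> \<in> arrows G" "src G \<alpha> = rng G \<beta>"
    using assms by (auto simp: composable_def)
  then have "(ginv G \<alpha>, \<alpha>) \<in> composable G"
    by (auto simp: composable_def inv_closed src_inv)
  from mult_assoc[OF this assms] show ?thesis
    using ab by (simp add: inv_mult rng_mult_left)
qed

lemma inv_inv:
  assumes "\<alpha> \<in> arrows G" shows "ginv G (ginv G \<alpha>) = \<alpha>"
proof -
  have "(ginv G \<alpha>, \<alpha>) \<in> composable G"
    using assms by (auto simp: composable_def inv_closed src_inv)
  from inv_mult_cancel[OF this] have "gmult G (ginv G (ginv G \<alpha>)) (src G \<alpha>) = \<alpha>"
    using assms by (simp add: inv_mult)
  moreover have "gmult G (ginv G (ginv G \<alpha>)) (src G \<alpha>) = ginv G (ginv G \<alpha>)"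
    using mult_src_right[of "ginv G (ginv G \<alpha>)"] assms
    by (simp add: inv_closed src_inv rng_inv)
  ultimately show ?thesis by simp
qed

lemma continuous_src: "continuous_map (arrow_top G) (unit_top G) (src G)"
proof -
  let ?c = "subtopology (prod_topology (arrow_top G) (arrow_top G)) (composable G)"
  have "continuous_map (arrow_top G) ?c (\<lambda>\<alpha>. (ginv G \<alpha>, \<alpha>))"
    by (auto simp: continuous_map_in_subtopology continuous_map_pairedI continuous_inv
        composable_def inv_closed src_inv)
  from continuous_map_compose[OF this continuous_mult]
  have "continuous_map (arrow_top G) (arrow_top G) (src G)"
    by (rule continuous_map_eq) (auto simp: inv_mult)
  then show ?thesis
    by (auto simp: unit_top_def continuous_map_in_subtopology src_in_units)
qed

lemma continuous_rng: "continuous_map (arrow_top G) (unit_top G) (rng G)"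
  by (rule continuous_map_eq[OF continuous_map_compose[OF continuous_inv continuous_src]])
     (auto simp: src_inv)

text \<open>
  A local homeomorphism is open. Together with continuity this reduces the condition that source
  and range be homeomorphisms on a bisection to their injectivity.
\<close>

lemma open_map_src: "open_map (arrow_top G) (unit_top G) (src G)"
  unfolding open_map_def
proof (intro allI impI)
  fix U assume U: "openin (arrow_top G) U"
  show "openin (unit_top G) (src G ` U)"
  proof (subst openin_subopen, intro ballI)
    fix u assume "u \<in> src G ` U"
    then obtain x where x: "x \<in> U" "u = src G x" by auto
    then have "x \<in> arrows G" using U openin_subset by blast
    then obtain N where N: "openin (arrow_top G) N" "x \<in> N" "openin (unit_top G) (src G ` N)"
      and hN: "homeomorphic_map (subtopology (arrow_top G) N) (subtopology (unit_top G) (src G ` N)) (src G)"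
      using src_local_homeomorphism unfolding local_homeomorphism_def by blast
    have "openin (subtopology (arrow_top G) N) (N \<inter> U)"
      using U N by (simp add: openin_subtopology_Int2)
    then have "openin (subtopology (unit_top G) (src G ` N)) (src G ` (N \<inter> U))"
      using homeomorphic_imp_open_map[OF hN] unfolding open_map_def by blast
    then have "openin (unit_top G) (src G ` (N \<inter> U))"
      using N(3) openin_trans_full by blast
    then show "\<exists>T. openin (unit_top G) T \<and> u \<in> T \<and> T \<subseteq> src G ` U"
      using x N by blast
  qed
qed

lemma inv_image_eq_vimage:
  assumes "A \<subseteq> arrows G"
  shows "ginv G ` A = {\<alpha> \<in> arrows G. ginv G \<alpha> \<in> A}"
proof (intro set_eqI iffI)
  fix \<alpha> assume "\<alpha> \<in> ginv G ` A"
  then show "\<alpha> \<in> {\<alpha> \<in> arrows G. ginv G \<alpha> \<in> A}"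
    using assms by (auto simp: inv_inv inv_closed subset_iff)
next
  fix \<alpha> assume "\<alpha> \<in> {\<alpha> \<in> arrows G. ginv G \<alpha> \<in> A}"
  then have "\<alpha> = ginv G (ginv G \<alpha>)" "ginv G \<alpha> \<in> A" by (auto simp: inv_inv)
  then show "\<alpha> \<in> ginv G ` A" by (rule image_eqI)
qed

lemma openin_inv_image:
  assumes "openin (arrow_top G) A" shows "openin (arrow_top G) (ginv G ` A)"
  using openin_continuous_map_preimage[OF continuous_inv assms] openin_subset[OF assms]
  by (simp add: inv_image_eq_vimage)

lemma open_map_rng: "open_map (arrow_top G) (unit_top G) (rng G)"
  unfolding open_map_def
proof (intro allI impI)
  fix U assume U: "openin (arrow_top G) U"
  have "src G ` ginv G ` U = rng G ` U"
    using openin_subset[OF U] by (force simp: image_image src_inv subset_iff)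
  then show "openin (unit_top G) (rng G ` U)"
    using open_map_src openin_inv_image[OF U] unfolding open_map_def by metis
qed

text \<open>
  Near a unit \<open>u\<close> the source map is injective on some open \<open>N\<close>. An arrow \<open>\<alpha>\<close> of \<open>N\<close> whose
  source is again in \<open>N\<close> has the same source as its own source, hence equals it.
\<close>

lemma openin_units: "openin (arrow_top G) (units G)"
proof (subst openin_subopen, intro ballI)
  fix u assume u: "u \<in> units G"
  then have "u \<in> arrows G" using units_subset by blast
  then obtain N where N: "openin (arrow_top G) N" "u \<in> N"
      and hN: "homeomorphic_map (subtopology (arrow_top G) N) (subtopology (unit_top G) (src G ` N)) (src G)"
    using src_local_homeomorphism unfolding local_homeomorphism_def by blast
  have NG: "N \<subseteq> arrows G" using N openin_subset by blast
  then have inj: "inj_on (src G) N"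
    using homeomorphic_imp_injective_map[OF hN] by (simp add: Int_absorb1)
  have "continuous_map (arrow_top G) (arrow_top G) (src G)"
    using continuous_src by (simp add: unit_top_def continuous_map_in_subtopology)
  from openin_continuous_map_preimage[OF this N(1)]
  have "openin (arrow_top G) (N \<inter> {\<alpha> \<in> arrows G. src G \<alpha> \<in> N})"
    using N(1) by blast
  moreover have "u \<in> N \<inter> {\<alpha> \<in> arrows G. src G \<alpha> \<in> N}"
    using N(2) NG u by (auto simp: src_unit)
  moreover have "N \<inter> {\<alpha> \<in> arrows G. src G \<alpha> \<in> N} \<subseteq> units G"
  proof
    fix \<alpha> assume a: "\<alpha> \<in> N \<inter> {\<alpha> \<in> arrows G. src G \<alpha> \<in> N}"
    then have "src G (src G \<alpha>) = src G \<alpha>" by (simp add: src_src)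
    then have "src G \<alpha> = \<alpha>" using inj a by (auto dest: inj_onD)
    then show "\<alpha> \<in> units G" using a src_in_units by force
  qed
  ultimately show "\<exists>T. openin (arrow_top G) T \<and> u \<in> T \<and> T \<subseteq> units G" by blast
qed

lemma openin_unit_top_iff: "openin (unit_top G) W \<longleftrightarrow> openin (arrow_top G) W \<and> W \<subseteq> units G"
  unfolding unit_top_def using openin_units by (rule openin_open_subtopology)

text \<open>
  In this form it is immediate that bisections pass to open subsets, to inverses and to sets of
  units.
\<close>

lemma open_bisection_iff:
  "open_bisection G B \<longleftrightarrow> openin (arrow_top G) B \<and> inj_on (rng G) B \<and> inj_on (src G) B"
proof
  assume B: "open_bisection G B"
  then have "B \<subseteq> arrows G" by (auto simp: open_bisection_def openin_subset)
  then show "openin (arrow_top G) B \<and> inj_on (rng G) B \<and> inj_on (src G) B"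
    using B unfolding open_bisection_def
    by (auto dest!: homeomorphic_imp_injective_map simp: Int_absorb1)
next
  assume "openin (arrow_top G) B \<and> inj_on (rng G) B \<and> inj_on (src G) B"
  then show "open_bisection G B"
    unfolding open_bisection_def
    using homeomorphic_map_restrict continuous_src continuous_rng open_map_src open_map_rng
    by (auto simp: open_map_def)
qed

section \<open>Compact open bisections\<close>

abbreviation cob where "cob \<equiv> compact_open_bisection G"

lemma cob_iff:
  "cob B \<longleftrightarrow> openin (arrow_top G) B \<and> compactin (arrow_top G) B \<and>
     inj_on (rng G) B \<and> inj_on (src G) B"
  by (auto simp: compact_open_bisection_def open_bisection_iff)

lemma cob_subset: "cob B \<Longrightarrow> B \<subseteq> arrows G"
  by (auto simp: cob_iff openin_subset)

lemma cob_empty: "cob {}"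
  by (auto simp: cob_iff)

lemma cob_inv:
  assumes "cob B" shows "cob (ginv G ` B)"
proof -
  have B: "B \<subseteq> arrows G" using assms by (rule cob_subset)
  have "inj_on (rng G) (ginv G ` B)"
    using assms B unfolding cob_iff inj_on_def by (auto simp: rng_inv subset_iff)
  moreover have "inj_on (src G) (ginv G ` B)"
    using assms B unfolding cob_iff inj_on_def by (auto simp: src_inv subset_iff)
  ultimately show ?thesis
    using assms by (auto simp: cob_iff openin_inv_image image_compactin[OF _ continuous_inv])
qed

lemma cob_src_image:
  assumes "cob B" shows "cob (src G ` B)"
proof -
  have "compactin (unit_top G) (src G ` B)"
    using assms image_compactin[OF _ continuous_src] by (auto simp: cob_iff)
  moreover have "openin (unit_top G) (src G ` B)"
    using assms open_map_src by (auto simp: cob_iff open_map_def)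
  moreover have "src G ` B \<subseteq> units G"
    using cob_subset[OF assms] src_in_units by auto
  moreover from this have "inj_on (rng G) (src G ` B)" "inj_on (src G) (src G ` B)"
    by (metis inj_onI rng_unit subsetD, metis inj_onI src_unit subsetD)
  ultimately show ?thesis
    by (simp add: cob_iff openin_unit_top_iff) (simp add: unit_top_def compactin_subtopology)
qed

text \<open>
  The range of \<open>B\<close> is a compact set of units, and compact sets in the Hausdorff unit space are
  closed, whereas \<open>B\<close> itself need not be closed in the space of arrows. The decomposition below
  therefore localises over the unit space and never over the arrows.
\<close>

lemma closedin_rng_image:
  assumes "cob B" shows "closedin (unit_top G) (rng G ` B)"
  using assms image_compactin[OF _ continuous_rng] compactin_imp_closedin[OF Hausdorff_unit_top]
  by (auto simp: cob_iff)

definition arrows_over :: "'g set \<Rightarrow> 'g set"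
  where "arrows_over W = {\<gamma> \<in> arrows G. rng G \<gamma> \<in> W}"

abbreviation clopen_units :: "'g set \<Rightarrow> bool" where
  "clopen_units W \<equiv> openin (unit_top G) W \<and> closedin (unit_top G) W"

text \<open>
  The arrows over a clopen set form a closed set, so cutting by such a condition preserves
  compactness. The intersection of two compact open bisections, by contrast, may fail to be compact
  when the space of arrows is not Hausdorff.
\<close>

lemma cob_Int_arrows_over:
  assumes "cob B" "clopen_units W" shows "cob (B \<inter> arrows_over W)"
proof -
  have "openin (arrow_top G) (arrows_over W)" "closedin (arrow_top G) (arrows_over W)"
    unfolding arrows_over_def
    using assms(2) openin_continuous_map_preimage[OF continuous_rng]
      closedin_continuous_map_preimage[OF continuous_rng] by blast+
  then show ?thesis
    using assms(1) by (auto simp: cob_iff compact_Int_closedin intro: inj_on_subset)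
qed

lemma clopen_nhd:
  assumes "openin (unit_top G) U" "u \<in> U"
  shows "\<exists>W. clopen_units W \<and> u \<in> W \<and> W \<subseteq> U"
proof -
  obtain W where W: "cob W" "u \<in> W" "W \<subseteq> U"
    using compact_open_bisection_basis[of U u] assms by (auto simp: openin_unit_top_iff)
  then have "W \<subseteq> units G" using assms by (auto simp: openin_unit_top_iff)
  then have "compactin (unit_top G) W" "openin (unit_top G) W"
    using W by (auto simp: cob_iff unit_top_def compactin_subtopology openin_units openin_open_subtopology)
  then show ?thesis
    using W compactin_imp_closedin[OF Hausdorff_unit_top] by blast
qed

lemma cob_disjoint_rng:
  assumes "cob B" "V \<subseteq> B" "D \<subseteq> B" "V \<inter> D = {}"
  shows "rng G ` V \<inter> rng G ` D = {}"
  using assms inj_on_image_Int[of "rng G" B V D] by (simp add: cob_iff)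

end

section \<open>Linear structure of the Steinberg algebra\<close>

lemma steinberg_algebra_iff:
  "f \<in> steinberg_algebra G \<longleftrightarrow>
     (\<exists>\<B> c. finite \<B> \<and> (\<forall>B\<in>\<B>. compact_open_bisection G B) \<and>
        f = (\<lambda>\<gamma>. \<Sum>B\<in>\<B>. c B * indicator B \<gamma>))"
  by (auto simp: steinberg_algebra_def)

lemma steinberg_indicator:
  assumes "compact_open_bisection G B" shows "indicator B \<in> steinberg_algebra G"
  unfolding steinberg_algebra_iff
  by (rule exI[of _ "{B}"], rule exI[of _ "\<lambda>_. 1"]) (auto simp: assms)

lemma steinberg_zero: "(\<lambda>_. 0) \<in> steinberg_algebra G"
  unfolding steinberg_algebra_iff by (rule exI[of _ "{}"]) auto

lemma steinberg_scale:
  assumes "f \<in> steinberg_algebra G" shows "(\<lambda>\<gamma>. a * f \<gamma>) \<in> steinberg_algebra G"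
proof -
  obtain \<B> c where "finite \<B>" "\<forall>B\<in>\<B>. compact_open_bisection G B"
      "f = (\<lambda>\<gamma>. \<Sum>B\<in>\<B>. c B * indicator B \<gamma>)"
    using assms by (auto simp: steinberg_algebra_iff)
  then show ?thesis
    unfolding steinberg_algebra_iff
    by (intro exI[of _ \<B>] exI[of _ "\<lambda>B. a * c B"])
       (simp add: sum_distrib_left mult.assoc del: sum_mult_indicator)
qed

lemma steinberg_add:
  assumes "f \<in> steinberg_algebra G" "g \<in> steinberg_algebra G"
  shows "(\<lambda>\<gamma>. f \<gamma> + g \<gamma>) \<in> steinberg_algebra G"
proof -
  obtain \<B> c where f: "finite \<B>" "\<forall>B\<in>\<B>. compact_open_bisection G B"
      "f = (\<lambda>\<gamma>. \<Sum>B\<in>\<B>. c B * indicator B \<gamma>)"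
    using assms by (auto simp: steinberg_algebra_iff)
  obtain \<C> d where g: "finite \<C>" "\<forall>B\<in>\<C>. compact_open_bisection G B"
      "g = (\<lambda>\<gamma>. \<Sum>B\<in>\<C>. d B * indicator B \<gamma>)"
    using assms by (auto simp: steinberg_algebra_iff)
  define e where "e B = (if B \<in> \<B> then c B else 0) + (if B \<in> \<C> then d B else 0)" for B
  have "f \<gamma> + g \<gamma> = (\<Sum>B\<in>\<B> \<union> \<C>. e B * indicator B \<gamma>)" for \<gamma>
  proof -
    have "f \<gamma> = (\<Sum>B\<in>\<B> \<union> \<C>. (if B \<in> \<B> then c B else 0) * indicator B \<gamma>)"
      unfolding f(3) using f(1) g(1) by (intro sum.mono_neutral_cong_left) auto
    moreover have "g \<gamma> = (\<Sum>B\<in>\<B> \<union> \<C>. (if B \<in> \<C> then d B else 0) * indicator B \<gamma>)"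
      unfolding g(3) using f(1) g(1) by (intro sum.mono_neutral_cong_left) auto
    ultimately show ?thesis
      by (simp add: e_def sum.distrib distrib_right)
  qed
  then show ?thesis
    unfolding steinberg_algebra_iff using f g
    by (intro exI[of _ "\<B> \<union> \<C>"] exI[of _ e]) auto
qed

lemma steinberg_sum:
  assumes "finite J" "\<And>j. j \<in> J \<Longrightarrow> f j \<in> steinberg_algebra G"
  shows "(\<lambda>\<gamma>. \<Sum>j\<in>J. f j \<gamma>) \<in> steinberg_algebra G"
  using assms by (induction J rule: finite_induct) (auto simp: steinberg_zero intro: steinberg_add)

context hausdorff_ample_groupoid
begin

section \<open>Convolution of indicators\<close>

definition arrow_prod :: "'g set \<Rightarrow> 'g set \<Rightarrow> 'g set" where
  "arrow_prod A B = {gmult G \<alpha> \<beta> |\<alpha> \<beta>. \<alpha> \<in> A \<and> \<beta> \<in> B \<and> (\<alpha>, \<beta>) \<in> composable G}"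

text \<open>
  When the range map is injective on \<open>A\<close>, the factor in \<open>A\<close> of a product is determined by the
  range of the product, and the other factor follows by cancellation. So the convolution sum has at
  most one nonzero term.
\<close>

lemma convolution_indicator:
  assumes inj: "inj_on (rng G) A"
  shows "convolution G (indicator A) (indicator B) = indicator (arrow_prod A B)"
proof
  fix \<gamma>
  let ?P = "{(\<alpha>, \<beta>). (\<alpha>, \<beta>) \<in> composable G \<and> gmult G \<alpha> \<beta> = \<gamma>}"
  let ?t = "\<lambda>(\<alpha>, \<beta>). indicator A \<alpha> * indicator B \<beta> :: complex"
  show "convolution G (indicator A) (indicator B) \<gamma> = (indicator (arrow_prod A B) \<gamma> :: complex)"
  proof (cases "\<gamma> \<in> arrow_prod A B")
    case False
    then have "infsum ?t ?P = 0"
      by (intro infsum_0) (auto simp: arrow_prod_def indicator_def)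
    with False show ?thesis by (simp add: convolution_def)
  next
    case True
    then obtain \<alpha> \<beta> where ab: "\<alpha> \<in> A" "\<beta> \<in> B" "(\<alpha>, \<beta>) \<in> composable G" "\<gamma> = gmult G \<alpha> \<beta>"
      by (auto simp: arrow_prod_def)
    have uniq: "\<alpha>' = \<alpha> \<and> \<beta>' = \<beta>"
      if "\<alpha>' \<in> A" "(\<alpha>', \<beta>') \<in> composable G" "gmult G \<alpha>' \<beta>' = \<gamma>" for \<alpha>' \<beta>'
    proof -
      have "rng G \<alpha>' = rng G \<alpha>" using that ab by (metis rng_mult)
      then have "\<alpha>' = \<alpha>" using inj that ab by (auto dest: inj_onD)
      then show ?thesis using that ab by (metis inv_mult_cancel)
    qed
    have "infsum ?t ?P = infsum ?t {(\<alpha>, \<beta>)}"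
    proof (rule infsum_cong_neutral)
      show "?t p = 0" if "p \<in> {(\<alpha>, \<beta>)} - ?P" for p
        using that ab by simp
      show "?t p = 0" if p: "p \<in> ?P - {(\<alpha>, \<beta>)}" for p
      proof -
        obtain \<alpha>' \<beta>' where p': "p = (\<alpha>', \<beta>')" by (cases p)
        then have "\<alpha>' \<notin> A" using p uniq[of \<alpha>' \<beta>'] by blast
        then show ?thesis using p' by simp
      qed
    qed simp
    also have "\<dots> = 1" using ab by simp
    finally show ?thesis using True by (simp add: convolution_def)
  qed
qed

lemma convolution_involution_disjoint:
  assumes "V \<subseteq> arrows G" "rng G ` V \<inter> rng G ` D = {}" "\<And>\<gamma>. \<gamma> \<notin> D \<Longrightarrow> g \<gamma> = 0"
  shows "convolution G (involution G (indicator V)) g = (\<lambda>_. 0)"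
proof
  fix \<gamma>
  have "involution G (indicator V) \<alpha> * g \<beta> = 0" if "(\<alpha>, \<beta>) \<in> composable G" for \<alpha> \<beta>
  proof (rule ccontr)
    assume "involution G (indicator V) \<alpha> * g \<beta> \<noteq> 0"
    then have "\<beta> \<in> D" "ginv G \<alpha> \<in> V" "\<alpha> \<in> arrows G"
      using assms(3) by (auto simp: involution_def indicator_def split: if_splits)
    moreover have "rng G (ginv G \<alpha>) = rng G \<beta>"
      using that by (auto simp: composable_def rng_inv)
    ultimately show False using assms(2) by blast
  qed
  then show "convolution G (involution G (indicator V)) g \<gamma> = 0"
    unfolding convolution_def by (intro infsum_0) auto
qed

lemma involution_indicator:
  assumes "V \<subseteq> arrows G"
  shows "involution G (indicator V) = indicator (ginv G ` V)"
  by (auto simp: fun_eq_iff involution_def indicator_def inv_image_eq_vimage[OF assms])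

text \<open>
  This is the identity behind the fact that the indicator of a bisection acts as a partial isometry:
  \<open>1\<^sub>V\<^sup>* * 1\<^sub>V\<close> is the indicator of a set of units, hence a projection.
\<close>

lemma arrow_prod_inv_self:
  assumes "cob V" shows "arrow_prod (ginv G ` V) V = src G ` V"
proof -
  have V: "V \<subseteq> arrows G" "inj_on (rng G) V" using assms by (auto simp: cob_iff cob_subset openin_subset)
  show ?thesis
  proof (intro set_eqI iffI)
    fix x assume "x \<in> arrow_prod (ginv G ` V) V"
    then obtain \<alpha> \<beta> where ab: "\<alpha> \<in> V" "\<beta> \<in> V" "(ginv G \<alpha>, \<beta>) \<in> composable G" "x = gmult G (ginv G \<alpha>) \<beta>"
      by (auto simp: arrow_prod_def)
    then have "rng G \<alpha> = rng G \<beta>" using V by (auto simp: composable_def src_inv subset_iff)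
    then have "\<alpha> = \<beta>" using ab V by (auto dest: inj_onD)
    then show "x \<in> src G ` V" using ab V by (auto simp: inv_mult subset_iff)
  next
    fix x assume "x \<in> src G ` V"
    then obtain \<alpha> where a: "\<alpha> \<in> V" "x = src G \<alpha>" by auto
    then have "x = gmult G (ginv G \<alpha>) \<alpha>" "(ginv G \<alpha>, \<alpha>) \<in> composable G"
      using V by (auto simp: inv_mult composable_def inv_closed src_inv subset_iff)
    then show "x \<in> arrow_prod (ginv G ` V) V" using a by (auto simp: arrow_prod_def)
  qed
qed

lemma inv_unit: 
  assumes "u \<in> units G" shows "ginv G u = u"
proof -
  have u: "u \<in> arrows G" using assms units_subset by blast
  have "gmult G (ginv G u) (src G (ginv G u)) = ginv G u"
    using u by (intro mult_src_right inv_closed)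
  then show ?thesis using inv_mult[OF u] u assms by (simp add: src_inv rng_unit src_unit)
qed

lemma arrow_prod_units:
  assumes "X \<subseteq> units G" shows "arrow_prod X X = X"
proof -
  have "X \<subseteq> arrows G" "\<And>u. u \<in> X \<Longrightarrow> src G u = u" "\<And>u. u \<in> X \<Longrightarrow> rng G u = u"
    using assms units_subset by (auto simp: src_unit rng_unit)
  note X = this
  have mult: "gmult G u u = u" if "u \<in> X" for u
    using rng_mult_left[of u] X that by auto
  show ?thesis
  proof (intro set_eqI iffI)
    fix x assume "x \<in> arrow_prod X X"
    then obtain u v where "u \<in> X" "v \<in> X" "src G u = rng G v" "x = gmult G u v"
      by (auto simp: arrow_prod_def composable_def)
    then show "x \<in> X" using X mult by metis
  next
    fix x assume "x \<in> X"
    then have "x = gmult G x x" "(x, x) \<in> composable G"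
      using X mult by (auto simp: composable_def)
    then show "x \<in> arrow_prod X X" using \<open>x \<in> X\<close> by (auto simp: arrow_prod_def)
  qed
qed

section \<open>Step functions on a bisection\<close>

text \<open>
  Finite linear combinations of indicators of pairwise disjoint compact open subsets of \<open>B\<close>, with
  coefficients of modulus at most \<open>M\<close>. The third argument records the union of the pieces. It
  states the disjointness of the next piece, and its indicator is what the norm of \<open>\<pi> g\<close> is compared
  with. The inductive form lets the norm estimate add one orthogonal piece at a time.
\<close>

inductive step_on :: "'g set \<Rightarrow> real \<Rightarrow> 'g set \<Rightarrow> ('g \<Rightarrow> complex) \<Rightarrow> bool"
  for B :: "'g set" and M :: real where
  zero: "step_on B M {} (\<lambda>_. 0)"
| piece: "step_on B M D g \<Longrightarrow> cob V \<Longrightarrow> V \<subseteq> B \<Longrightarrow> V \<inter> D = {} \<Longrightarrow> cmod a \<le> M \<Longrightarrow>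
    step_on B M (V \<union> D) (\<lambda>\<gamma>. a * indicator V \<gamma> + g \<gamma>)"

lemma step_on_vanishes: "step_on B M D g \<Longrightarrow> \<gamma> \<notin> D \<Longrightarrow> g \<gamma> = 0"
  by (induction rule: step_on.induct) auto

lemma step_on_subset: "step_on B M D g \<Longrightarrow> D \<subseteq> B"
  by (induction rule: step_on.induct) auto

lemma step_on_steinberg: "step_on B M D g \<Longrightarrow> g \<in> steinberg_algebra G"
proof (induction rule: step_on.induct)
  case (piece D g V a)
  show ?case
    using steinberg_add[OF steinberg_scale[OF steinberg_indicator[OF piece(2)]] piece(6)] .
qed (rule steinberg_zero)

lemma step_on_cob: 
  assumes "step_on B M D g" "cob B" shows "cob D"
  using assms
proof (induction rule: step_on.induct)
  case (piece D g V a)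
  then have "V \<union> D \<subseteq> B" using step_on_subset by blast
  with piece show ?case
    by (auto simp: cob_iff compactin_Un openin_Un intro: inj_on_subset)
qed (simp add: cob_empty)

lemma step_on_restrict:
  assumes "step_on B M D g" "clopen_units W"
  shows "step_on B M (D \<inter> arrows_over W) (\<lambda>\<gamma>. g \<gamma> * indicator (arrows_over W) \<gamma>)"
  using assms
proof (induction rule: step_on.induct)
  case zero show ?case using step_on.zero by simp
next
  case (piece D g V a)
  have "step_on B M ((V \<inter> arrows_over W) \<union> (D \<inter> arrows_over W))
     (\<lambda>\<gamma>. a * indicator (V \<inter> arrows_over W) \<gamma> + g \<gamma> * indicator (arrows_over W) \<gamma>)"
    using piece by (intro step_on.piece) (auto intro: cob_Int_arrows_over)
  moreover have "(V \<inter> arrows_over W) \<union> (D \<inter> arrows_over W) = (V \<union> D) \<inter> arrows_over W" by blast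
  ultimately show ?case by (simp add: indicator_inter_arith algebra_simps)
qed

lemma step_on_add:
  assumes "step_on B M D g" "step_on B M E h" "D \<inter> E = {}"
  shows "step_on B M (D \<union> E) (\<lambda>\<gamma>. g \<gamma> + h \<gamma>)"
  using assms
proof (induction rule: step_on.induct)
  case zero then show ?case by simp
next
  case (piece D g V a)
  then have "step_on B M (D \<union> E) (\<lambda>\<gamma>. g \<gamma> + h \<gamma>)" by blast
  then have "step_on B M (V \<union> (D \<union> E)) (\<lambda>\<gamma>. a * indicator V \<gamma> + (g \<gamma> + h \<gamma>))"
    using piece by (intro step_on.piece) auto
  then show ?case by (simp add: Un_assoc add.assoc)
qed

lemma step_on_single:
  assumes "cob V" "V \<subseteq> B" "cmod a \<le> M"
  shows "step_on B M V (\<lambda>\<gamma>. a * indicator V \<gamma>)"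
  using step_on.piece[OF step_on.zero assms(1,2) _ assms(3)] by simp

section \<open>Decomposition into step functions\<close>

text \<open>
  The step functions are required to be supported over \<open>W\<close> so that decompositions over disjoint
  sets can be added without interference.
\<close>

definition decomposes_over :: "'g set set \<Rightarrow> real \<Rightarrow> ('g \<Rightarrow> complex) \<Rightarrow> 'g set \<Rightarrow> bool" where
  "decomposes_over \<J> M f W \<longleftrightarrow>
     (\<exists>g D. (\<forall>J\<in>\<J>. step_on J M (D J) (g J) \<and> D J \<subseteq> arrows_over W) \<and>
        (\<forall>\<gamma>\<in>arrows_over W. f \<gamma> = (\<Sum>J\<in>\<J>. g J \<gamma>)))"

lemma decomposes_over_subset:
  assumes "decomposes_over \<J> M f W" "clopen_units W'" "W' \<subseteq> W"
  shows "decomposes_over \<J> M f W'"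
proof -
  obtain g D where gD: "\<And>J. J \<in> \<J> \<Longrightarrow> step_on J M (D J) (g J)"
      "\<And>\<gamma>. \<gamma> \<in> arrows_over W \<Longrightarrow> f \<gamma> = (\<Sum>J\<in>\<J>. g J \<gamma>)"
    using assms(1) unfolding decomposes_over_def by blast
  have sub: "arrows_over W' \<subseteq> arrows_over W" using assms(3) by (auto simp: arrows_over_def)
  show ?thesis
    unfolding decomposes_over_def
  proof (intro exI conjI ballI)
    fix J assume "J \<in> \<J>"
    then show "step_on J M (D J \<inter> arrows_over W') (\<lambda>\<gamma>. g J \<gamma> * indicator (arrows_over W') \<gamma>)"
      using step_on_restrict gD(1) assms(2) by blast
    show "D J \<inter> arrows_over W' \<subseteq> arrows_over W'" by blast
  next
    fix \<gamma> assume "\<gamma> \<in> arrows_over W'"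
    then show "f \<gamma> = (\<Sum>J\<in>\<J>. g J \<gamma> * indicator (arrows_over W') \<gamma>)"
      using gD(2) sub by auto
  qed
qed

lemma decomposes_over_disjoint_Un:
  assumes "decomposes_over \<J> M f W" "decomposes_over \<J> M f W'" "W \<inter> W' = {}"
  shows "decomposes_over \<J> M f (W \<union> W')"
proof -
  obtain g D where gD: "\<And>J. J \<in> \<J> \<Longrightarrow> step_on J M (D J) (g J)" "\<And>J. J \<in> \<J> \<Longrightarrow> D J \<subseteq> arrows_over W"
      "\<And>\<gamma>. \<gamma> \<in> arrows_over W \<Longrightarrow> f \<gamma> = (\<Sum>J\<in>\<J>. g J \<gamma>)"
    using assms(1) unfolding decomposes_over_def by blast
  obtain h E where hE: "\<And>J. J \<in> \<J> \<Longrightarrow> step_on J M (E J) (h J)" "\<And>J. J \<in> \<J> \<Longrightarrow> E J \<subseteq> arrows_over W'"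
      "\<And>\<gamma>. \<gamma> \<in> arrows_over W' \<Longrightarrow> f \<gamma> = (\<Sum>J\<in>\<J>. h J \<gamma>)"
    using assms(2) unfolding decomposes_over_def by blast
  have Un: "arrows_over (W \<union> W') = arrows_over W \<union> arrows_over W'" and disj: "arrows_over W \<inter> arrows_over W' = {}"
    using assms(3) by (auto simp: arrows_over_def)
  show ?thesis
    unfolding decomposes_over_def
  proof (intro exI conjI ballI)
    fix J assume J: "J \<in> \<J>"
    then have "D J \<inter> E J = {}" using gD(2) hE(2) disj by blast
    then show "step_on J M (D J \<union> E J) (\<lambda>\<gamma>. g J \<gamma> + h J \<gamma>)"
      using step_on_add J gD(1) hE(1) by blast
    show "D J \<union> E J \<subseteq> arrows_over (W \<union> W')"
      unfolding Un using J gD(2) hE(2) by blast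
  next
    fix \<gamma> assume "\<gamma> \<in> arrows_over (W \<union> W')"
    then consider "\<gamma> \<in> arrows_over W" "\<gamma> \<notin> arrows_over W'" | "\<gamma> \<in> arrows_over W'" "\<gamma> \<notin> arrows_over W"
      using Un disj by blast
    then show "f \<gamma> = (\<Sum>J\<in>\<J>. g J \<gamma> + h J \<gamma>)"
    proof cases
      case 1
      then have "h J \<gamma> = 0" if "J \<in> \<J>" for J
        using step_on_vanishes hE(1,2) that by blast
      with 1 show ?thesis by (simp add: gD(3))
    next
      case 2
      then have "g J \<gamma> = 0" if "J \<in> \<J>" for J
        using step_on_vanishes gD(1,2) that by blast
      with 2 show ?thesis by (simp add: hE(3))
    qed
  qed
qed

text \<open>
  Each set is first made disjoint from the union of the others; clopen sets are closed under this
  operation, and decompositions restrict to smaller clopen sets.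
\<close>

lemma decomposes_over_Union:
  assumes "finite \<W>" "\<And>W. W \<in> \<W> \<Longrightarrow> clopen_units W \<and> decomposes_over \<J> M f W"
  shows "clopen_units (\<Union>\<W>) \<and> decomposes_over \<J> M f (\<Union>\<W>)"
  using assms
proof (induction \<W> rule: finite_induct)
  case empty
  have "decomposes_over \<J> M f {}"
    unfolding decomposes_over_def
    by (rule exI[of _ "\<lambda>_ _. 0"], rule exI[of _ "\<lambda>_. {}"]) (simp add: arrows_over_def step_on.zero)
  then show ?case by simp
next
  case (insert W \<W>)
  then have IH: "clopen_units (\<Union>\<W>)" "decomposes_over \<J> M f (\<Union>\<W>)" and W: "clopen_units W" "decomposes_over \<J> M f W"
    by auto
  have "clopen_units (W - \<Union>\<W>)"
    using IH(1) W(1) by (auto intro: openin_diff closedin_diff)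
  then have "decomposes_over \<J> M f (W - \<Union>\<W>)"
    using decomposes_over_subset[OF W(2)] by blast
  from decomposes_over_disjoint_Un[OF this IH(2)]
  have "decomposes_over \<J> M f (W \<union> \<Union>\<W>)" by auto
  then show ?case using IH(1) W(1) by (auto intro: openin_Un closedin_Un)
qed

text \<open>
  Let \<open>\<Delta>\<close> be the finite set of arrows with range \<open>u\<close> in the bisections \<open>B\<close> that define \<open>f\<close>. Around
  each \<open>\<delta> \<in> \<Delta>\<close> take a bisection \<open>N \<delta>\<close> contained in every \<open>B\<close> that contains \<open>\<delta>\<close>. An arrow of such a
  \<open>B\<close> is determined by its range, so over a small neighbourhood of \<open>u\<close> the set \<open>B\<close> coincides with
  \<open>N \<delta>\<close>, and with the empty set if \<open>u\<close> is not in the range of \<open>B\<close>. Collecting terms,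
  \<open>f = (\<Sum>\<delta>\<in>\<Delta>. f \<delta> * 1\<^bsub>N \<delta>\<^esub>)\<close> near \<open>u\<close>. The point of this regrouping is that the coefficients
  are now values of \<open>f\<close> and so are bounded by \<open>M\<close>, whereas the original coefficients may be large
  and cancel; and only those \<open>\<delta>\<close> with \<open>f \<delta> \<noteq> 0\<close> survive, each of which lies in some member of \<open>\<J>\<close>.
  Two different \<open>\<delta>\<close> cannot lie in the same member, as they have the same range.
\<close>

lemma local_decomposition:
  assumes f: "f \<in> steinberg_algebra G"
    and \<J>: "finite \<J>" "\<And>J. J \<in> \<J> \<Longrightarrow> cob J" "osupp G f \<subseteq> \<Union>\<J>"
    and M: "\<And>\<gamma>. \<gamma> \<in> arrows G \<Longrightarrow> cmod (f \<gamma>) \<le> M"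
    and u: "u \<in> units G"
  shows "\<exists>W. clopen_units W \<and> u \<in> W \<and> decomposes_over \<J> M f W"
proof -
  obtain \<B> c where \<B>: "finite \<B>" "\<And>B. B \<in> \<B> \<Longrightarrow> cob B"
      and f_eq: "f = (\<lambda>\<gamma>. \<Sum>B\<in>\<B>. c B * indicator B \<gamma>)"
    using f by (auto simp: steinberg_algebra_iff)
  define \<Delta> where "\<Delta> = {\<delta> \<in> \<Union>\<B>. rng G \<delta> = u}"
  have \<Delta>_arrows: "\<Delta> \<subseteq> arrows G"
    using \<B>(2) cob_subset by (auto simp: \<Delta>_def)
  have unique: "\<delta> = \<delta>'" if "cob B" "\<delta> \<in> B" "\<delta>' \<in> B" "rng G \<delta> = rng G \<delta>'" for B \<delta> \<delta>'
    using that by (auto simp: cob_iff dest: inj_onD)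
  have "finite (B \<inter> \<Delta>)" if "B \<in> \<B>" for B
  proof (cases "B \<inter> \<Delta> = {}")
    case False
    then obtain \<delta> where "\<delta> \<in> B \<inter> \<Delta>" by blast
    then have "B \<inter> \<Delta> \<subseteq> {\<delta>}" using unique[OF \<B>(2)[OF that]] by (auto simp: \<Delta>_def)
    then show ?thesis by (rule finite_subset) simp
  qed simp
  moreover have "\<Delta> = (\<Union>B\<in>\<B>. B \<inter> \<Delta>)" by (auto simp: \<Delta>_def)
  ultimately have fin_\<Delta>: "finite \<Delta>" using \<B>(1) by (metis finite_UN_I)

  \<comment> \<open>A choice, for each point of the fibre where \<open>f\<close> does not vanish, of a member of \<open>\<J>\<close> through it.\<close>
  have "\<exists>j. f \<delta> \<noteq> 0 \<longrightarrow> j \<in> \<J> \<and> \<delta> \<in> j" if "\<delta> \<in> \<Delta>" for \<delta>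
    using that \<Delta>_arrows \<J>(3) by (auto simp: osupp_def)
  then obtain j where j: "\<And>\<delta>. \<delta> \<in> \<Delta> \<Longrightarrow> f \<delta> \<noteq> 0 \<Longrightarrow> j \<delta> \<in> \<J> \<and> \<delta> \<in> j \<delta>"
    by metis

  have "\<forall>\<delta>\<in>\<Delta>. \<exists>N. cob N \<and> \<delta> \<in> N \<and> (\<forall>B\<in>\<B>. \<delta> \<in> B \<longrightarrow> N \<subseteq> B) \<and> (f \<delta> \<noteq> 0 \<longrightarrow> N \<subseteq> j \<delta>)"
  proof
    fix \<delta> assume \<delta>: "\<delta> \<in> \<Delta>"
    define \<U> where "\<U> = {B \<in> \<B>. \<delta> \<in> B} \<union> (if f \<delta> \<noteq> 0 then {j \<delta>} else {})"
    have "finite \<U>" "\<U> \<noteq> {}" using \<delta> \<B>(1) by (auto simp: \<U>_def \<Delta>_def)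
    moreover have "openin (arrow_top G) U \<and> \<delta> \<in> U" if "U \<in> \<U>" for U
      using that \<B>(2) \<J>(2) j[OF \<delta>] by (auto simp: \<U>_def cob_iff split: if_splits)
    ultimately have "openin (arrow_top G) (\<Inter>\<U>)" "\<delta> \<in> \<Inter>\<U>"
      by (auto intro: openin_Inter)
    then obtain N where "cob N" "\<delta> \<in> N" "N \<subseteq> \<Inter>\<U>"
      using compact_open_bisection_basis by blast
    then show "\<exists>N. cob N \<and> \<delta> \<in> N \<and> (\<forall>B\<in>\<B>. \<delta> \<in> B \<longrightarrow> N \<subseteq> B) \<and> (f \<delta> \<noteq> 0 \<longrightarrow> N \<subseteq> j \<delta>)"
      by (intro exI[of _ N]) (auto simp: \<U>_def)
  qed
  from bchoice[OF this] obtain N where "\<forall>\<delta>\<in>\<Delta>. cob (N \<delta>) \<and> \<delta> \<in> N \<delta> \<and>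
      (\<forall>B\<in>\<B>. \<delta> \<in> B \<longrightarrow> N \<delta> \<subseteq> B) \<and> (f \<delta> \<noteq> 0 \<longrightarrow> N \<delta> \<subseteq> j \<delta>)" ..
  then have N: "\<And>\<delta>. \<delta> \<in> \<Delta> \<Longrightarrow> cob (N \<delta>)" "\<And>\<delta>. \<delta> \<in> \<Delta> \<Longrightarrow> \<delta> \<in> N \<delta>"
      "\<And>\<delta> B. \<delta> \<in> \<Delta> \<Longrightarrow> B \<in> \<B> \<Longrightarrow> \<delta> \<in> B \<Longrightarrow> N \<delta> \<subseteq> B"
      "\<And>\<delta>. \<delta> \<in> \<Delta> \<Longrightarrow> f \<delta> \<noteq> 0 \<Longrightarrow> N \<delta> \<subseteq> j \<delta>"
    by simp_all

  \<comment> \<open>Over \<open>W\<close> every \<open>N \<delta>\<close> is to be a section of the range map, and the bisections \<open>B\<close>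
    with no arrow above \<open>u\<close> are to be absent; \<open>units G\<close> keeps the intersection nonvacuous.\<close>
  define \<O> where "\<O> = insert (units G) ((\<lambda>\<delta>. rng G ` N \<delta>) ` \<Delta> \<union>
      (\<lambda>B. units G - rng G ` B) ` {B \<in> \<B>. u \<notin> rng G ` B})"
  have "openin (unit_top G) (rng G ` N \<delta>)" if "\<delta> \<in> \<Delta>" for \<delta>
    using open_map_rng N(1)[OF that] by (auto simp: open_map_def cob_iff)
  moreover have "openin (unit_top G) (units G - rng G ` B)" if "B \<in> \<B>" for B
    using closedin_rng_image[OF \<B>(2)[OF that]] by (simp add: closedin_def topspace_unit_top)
  moreover have "openin (unit_top G) (units G)"
    using openin_topspace[of "unit_top G"] by (simp add: topspace_unit_top)
  ultimately have "openin (unit_top G) (\<Inter>\<O>)"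
    using fin_\<Delta> \<B>(1) by (intro openin_Inter) (auto simp: \<O>_def)
  moreover have "u \<in> \<Inter>\<O>"
  proof -
    have "u \<in> rng G ` N \<delta>" if "\<delta> \<in> \<Delta>" for \<delta>
      using N(2)[OF that] that by (auto simp: \<Delta>_def)
    then show ?thesis using u by (auto simp: \<O>_def)
  qed
  ultimately obtain W where W: "clopen_units W" "u \<in> W" "W \<subseteq> \<Inter>\<O>"
    using clopen_nhd[of "\<Inter>\<O>" u] by blast
  have W_N: "W \<subseteq> rng G ` N \<delta>" if "\<delta> \<in> \<Delta>" for \<delta>
    using W(3) that by (auto simp: \<O>_def)
  have W_B: "W \<inter> rng G ` B = {}" if "B \<in> \<B>" "u \<notin> rng G ` B" for B
  proof -
    have "units G - rng G ` B \<in> \<O>" using that by (auto simp: \<O>_def)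
    then show ?thesis using W(3) by blast
  qed

  have f_local: "f \<gamma> = (\<Sum>\<delta>\<in>\<Delta>. f \<delta> * indicator (N \<delta>) \<gamma>)" if \<gamma>: "\<gamma> \<in> arrows_over W" for \<gamma>
  proof -
    \<comment> \<open>At most one summand is nonzero: the fibre over \<open>u\<close> meets \<open>B\<close> in at most one point.\<close>
    have ind: "(indicator B \<gamma> :: complex) = (\<Sum>\<delta>\<in>\<Delta>. indicator B \<delta> * indicator (N \<delta>) \<gamma>)" if B: "B \<in> \<B>" for B
    proof (cases "u \<in> rng G ` B")
      case False
      then have "\<gamma> \<notin> B" using W_B[OF B] \<gamma> by (auto simp: arrows_over_def)
      moreover have "\<delta> \<notin> B" if "\<delta> \<in> \<Delta>" for \<delta>
        using False that by (auto simp: \<Delta>_def)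
      ultimately show ?thesis by (simp add: indicator_def)
    next
      case True
      then obtain \<delta> where \<delta>: "\<delta> \<in> B" "rng G \<delta> = u" by auto
      then have \<delta>\<Delta>: "\<delta> \<in> \<Delta>" using B by (auto simp: \<Delta>_def)
      have "\<gamma> \<in> B \<longleftrightarrow> \<gamma> \<in> N \<delta>"
      proof
        assume "\<gamma> \<in> B"
        moreover obtain \<gamma>' where "\<gamma>' \<in> N \<delta>" "rng G \<gamma>' = rng G \<gamma>"
          using W_N[OF \<delta>\<Delta>] \<gamma> by (auto simp: arrows_over_def image_iff subset_iff)
        ultimately show "\<gamma> \<in> N \<delta>"
          using N(3)[OF \<delta>\<Delta> B \<delta>(1)] unique[OF \<B>(2)[OF B], of \<gamma> \<gamma>'] by auto
      qed (use N(3)[OF \<delta>\<Delta> B \<delta>(1)] in auto)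
      moreover have "indicator B \<delta>' = (0::complex)" if "\<delta>' \<in> \<Delta> - {\<delta>}" for \<delta>'
        using that unique[OF \<B>(2)[OF B] \<delta>(1), of \<delta>'] \<delta>(2) by (auto simp: \<Delta>_def indicator_def)
      then have "(\<Sum>\<delta>\<in>\<Delta>. indicator B \<delta> * indicator (N \<delta>) \<gamma>) = indicator B \<delta> * (indicator (N \<delta>) \<gamma> :: complex)"
        using fin_\<Delta> \<delta>\<Delta> by (subst sum.remove[of _ \<delta>]) (auto intro!: sum.neutral)
      ultimately show ?thesis using \<delta>(1) by (simp add: indicator_def)
    qed
    have "f \<gamma> = (\<Sum>B\<in>\<B>. c B * (\<Sum>\<delta>\<in>\<Delta>. indicator B \<delta> * indicator (N \<delta>) \<gamma>))"
      unfolding f_eq using ind by (intro sum.cong) (simp_all only:)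
    also have "\<dots> = (\<Sum>B\<in>\<B>. \<Sum>\<delta>\<in>\<Delta>. c B * indicator B \<delta> * indicator (N \<delta>) \<gamma>)"
      unfolding sum_distrib_left mult.assoc ..
    also have "\<dots> = (\<Sum>\<delta>\<in>\<Delta>. \<Sum>B\<in>\<B>. c B * indicator B \<delta> * indicator (N \<delta>) \<gamma>)"
      by (rule sum.swap)
    also have "\<dots> = (\<Sum>\<delta>\<in>\<Delta>. f \<delta> * indicator (N \<delta>) \<gamma>)"
      unfolding f_eq sum_distrib_right ..
    finally show ?thesis .
  qed

  define \<Delta>' where "\<Delta>' = {\<delta> \<in> \<Delta>. f \<delta> \<noteq> 0}"
  have fin_\<Delta>': "finite \<Delta>'" using fin_\<Delta> by (simp add: \<Delta>'_def)
  have j_inj: "\<delta> = \<delta>'" if "\<delta> \<in> \<Delta>'" "\<delta>' \<in> \<Delta>'" "j \<delta> = j \<delta>'" for \<delta> \<delta>'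
    using that j[of \<delta>] j[of \<delta>'] unique[OF \<J>(2)] by (auto simp: \<Delta>'_def \<Delta>_def)
  \<comment> \<open>Step function and union of its pieces form a pair, so that a single choice yields both.\<close>
  have step_J: "\<exists>gD. step_on J M (snd gD) (fst gD) \<and> snd gD \<subseteq> arrows_over W \<and>
      (\<forall>\<gamma>\<in>arrows_over W. fst gD \<gamma> = (\<Sum>\<delta>\<in>{\<delta> \<in> \<Delta>'. j \<delta> = J}. f \<delta> * indicator (N \<delta>) \<gamma>))"
    if "J \<in> \<J>" for J
  proof (cases "{\<delta> \<in> \<Delta>'. j \<delta> = J} = {}")
    case True
    show ?thesis
      unfolding True by (intro exI[of _ "(\<lambda>_. 0, {})"]) (simp add: step_on.zero)
  next
    case False
    then obtain \<delta> where \<delta>: "\<delta> \<in> \<Delta>'" "j \<delta> = J" by blast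
    then have eq: "{\<delta> \<in> \<Delta>'. j \<delta> = J} = {\<delta>}" using j_inj by blast
    have \<delta>\<Delta>: "\<delta> \<in> \<Delta>" "f \<delta> \<noteq> 0" using \<delta> by (auto simp: \<Delta>'_def)
    have "step_on J M (N \<delta> \<inter> arrows_over W) (\<lambda>\<gamma>. f \<delta> * indicator (N \<delta> \<inter> arrows_over W) \<gamma>)"
    proof (rule step_on_single)
      show "cob (N \<delta> \<inter> arrows_over W)" using cob_Int_arrows_over N(1) \<delta>\<Delta>(1) W(1) by blast
      show "N \<delta> \<inter> arrows_over W \<subseteq> J" using N(4)[OF \<delta>\<Delta>] \<delta>(2) by blast
      show "cmod (f \<delta>) \<le> M" using M \<Delta>_arrows \<delta>\<Delta>(1) by blast
    qed
    then show ?thesis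
      unfolding eq
      by (intro exI[of _ "(\<lambda>\<gamma>. f \<delta> * indicator (N \<delta> \<inter> arrows_over W) \<gamma>, N \<delta> \<inter> arrows_over W)"])
         (simp add: indicator_def)
  qed
  obtain gD where gD: "\<forall>J\<in>\<J>. step_on J M (snd (gD J)) (fst (gD J)) \<and> snd (gD J) \<subseteq> arrows_over W \<and>
      (\<forall>\<gamma>\<in>arrows_over W. fst (gD J) \<gamma> = (\<Sum>\<delta>\<in>{\<delta> \<in> \<Delta>'. j \<delta> = J}. f \<delta> * indicator (N \<delta>) \<gamma>))"
    using bchoice[OF ballI[OF step_J]] ..
  have "f \<gamma> = (\<Sum>J\<in>\<J>. fst (gD J) \<gamma>)" if \<gamma>: "\<gamma> \<in> arrows_over W" for \<gamma>
  proof -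
    have "f \<gamma> = (\<Sum>\<delta>\<in>\<Delta>'. f \<delta> * indicator (N \<delta>) \<gamma>)"
      unfolding f_local[OF \<gamma>] using fin_\<Delta>
      by (intro sum.mono_neutral_right) (auto simp: \<Delta>'_def)
    also have "\<dots> = (\<Sum>J\<in>\<J>. \<Sum>\<delta>\<in>{\<delta> \<in> \<Delta>'. j \<delta> = J}. f \<delta> * indicator (N \<delta>) \<gamma>)"
      using fin_\<Delta>' \<J>(1) j by (intro sum.group[symmetric]) (auto simp: \<Delta>'_def)
    also have "\<dots> = (\<Sum>J\<in>\<J>. fst (gD J) \<gamma>)"
      using gD \<gamma> by (intro sum.cong) simp_all
    finally show ?thesis .
  qed
  then have "decomposes_over \<J> M f W"
    unfolding decomposes_over_def using gD
    by (intro exI[of _ "\<lambda>J. fst (gD J)"] exI[of _ "\<lambda>J. snd (gD J)"]) blast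
  then show ?thesis using W by blast
qed

lemma decomposition:
  assumes f: "f \<in> steinberg_algebra G"
    and \<J>: "finite \<J>" "\<And>J. J \<in> \<J> \<Longrightarrow> cob J" "osupp G f \<subseteq> \<Union>\<J>"
    and M: "\<And>\<gamma>. \<gamma> \<in> arrows G \<Longrightarrow> cmod (f \<gamma>) \<le> M"
  shows "\<exists>g D. (\<forall>J\<in>\<J>. step_on J M (D J) (g J)) \<and> f = (\<lambda>\<gamma>. \<Sum>J\<in>\<J>. g J \<gamma>)"
proof -
  obtain \<B> c where \<B>: "finite \<B>" "\<And>B. B \<in> \<B> \<Longrightarrow> cob B"
      and f_eq: "f = (\<lambda>\<gamma>. \<Sum>B\<in>\<B>. c B * indicator B \<gamma>)"
    using f by (auto simp: steinberg_algebra_iff)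
  have "compactin (unit_top G) (\<Union>B\<in>\<B>. rng G ` B)"
    using \<B> image_compactin[OF _ continuous_rng]
    by (intro compactin_Union) (auto simp: cob_iff)
  moreover have "(\<Union>B\<in>\<B>. rng G ` B) \<subseteq> \<Union>{W. clopen_units W \<and> decomposes_over \<J> M f W}"
  proof
    fix u assume "u \<in> (\<Union>B\<in>\<B>. rng G ` B)"
    then have "u \<in> units G" using \<B>(2) cob_subset rng_in_units by fast
    from local_decomposition[OF assms this]
    show "u \<in> \<Union>{W. clopen_units W \<and> decomposes_over \<J> M f W}" by blast
  qed
  moreover have "\<forall>W\<in>{W. clopen_units W \<and> decomposes_over \<J> M f W}. openin (unit_top G) W"
    by blast
  ultimately obtain \<W> where \<W>: "finite \<W>" "\<W> \<subseteq> {W. clopen_units W \<and> decomposes_over \<J> M f W}"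
      "(\<Union>B\<in>\<B>. rng G ` B) \<subseteq> \<Union>\<W>"
    unfolding compactin_def by meson
  then have "decomposes_over \<J> M f (\<Union>\<W>)"
    using decomposes_over_Union[OF \<W>(1), of \<J> M f] by blast
  then obtain g D where gD: "\<And>J. J \<in> \<J> \<Longrightarrow> step_on J M (D J) (g J)" "\<And>J. J \<in> \<J> \<Longrightarrow> D J \<subseteq> arrows_over (\<Union>\<W>)"
      "\<And>\<gamma>. \<gamma> \<in> arrows_over (\<Union>\<W>) \<Longrightarrow> f \<gamma> = (\<Sum>J\<in>\<J>. g J \<gamma>)"
    unfolding decomposes_over_def by blast
  have "f \<gamma> = (\<Sum>J\<in>\<J>. g J \<gamma>)" for \<gamma>
  proof (cases "\<gamma> \<in> arrows_over (\<Union>\<W>)")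
    case False
    then have "\<gamma> \<notin> B" if "B \<in> \<B>" for B
      using that \<W>(3) cob_subset[OF \<B>(2)[OF that]] by (auto simp: arrows_over_def)
    then have "f \<gamma> = 0" by (simp add: f_eq)
    moreover have "g J \<gamma> = 0" if "J \<in> \<J>" for J
      using step_on_vanishes[OF gD(1)[OF that]] gD(2)[OF that] False by blast
    ultimately show ?thesis by simp
  qed (rule gD(3))
  with gD(1) show ?thesis by blast
qed

end

section \<open>Operators on a Hilbert space\<close>

lemma cinner_add_right: "cinner (x::'h::complex_hilbert) (y + z) = cinner x y + cinner x z"
  by (metis cinner_add_left cinner_commute complex_cnj_add)

lemma norm_scaleC: "norm (c *\<^sub>C (x::'h::complex_hilbert)) = cmod c * norm x"
proof -
  have "cinner x (c *\<^sub>C x) = cnj c * cinner x x"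
    by (metis cinner_commute cinner_scaleC_left complex_cnj_mult)
  then have "complex_of_real ((norm (c *\<^sub>C x))\<^sup>2) = c * cnj c * complex_of_real ((norm x)\<^sup>2)"
    by (simp only: cinner_self[symmetric] cinner_scaleC_left) (simp add: mult.assoc)
  also have "\<dots> = complex_of_real ((cmod c * norm x)\<^sup>2)"
    by (simp only: complex_norm_square power_mult_distrib of_real_mult)
  finally have "(norm (c *\<^sub>C x))\<^sup>2 = (cmod c * norm x)\<^sup>2"
    by (simp only: of_real_eq_iff)
  then show ?thesis by (simp add: power2_eq_iff_nonneg)
qed

lemma norm_add_orthogonal:
  assumes "cinner x y = 0"
  shows "(norm (x + y :: 'h::complex_hilbert))\<^sup>2 = (norm x)\<^sup>2 + (norm y)\<^sup>2"
proof -
  have "cinner y x = 0" using assms by (metis cinner_commute complex_cnj_zero)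
  then have "complex_of_real ((norm (x + y))\<^sup>2) = complex_of_real ((norm x)\<^sup>2 + (norm y)\<^sup>2)"
    using assms by (simp only: cinner_self[symmetric] cinner_add_left cinner_add_right of_real_add) simp
  then show ?thesis by (simp only: of_real_eq_iff)
qed

text \<open>
  The vectors \<open>P x\<close> and \<open>x - P x\<close> are orthogonal with sum \<open>x\<close>.
\<close>

lemma projection_contraction:
  fixes P :: "'h::complex_hilbert \<Rightarrow>\<^sub>L 'h"
  assumes "is_adjoint P P" "P o\<^sub>L P = P"
  shows "norm (P x) \<le> norm x"
proof -
  have PP: "P (P y) = P y" for y
    using assms(2) by (metis blinfun_apply_blinfun_compose)
  have "cinner (P x) (x - P x) = cinner x (P (x - P x))"
    using assms(1) by (simp add: is_adjoint_def)
  also have "P (x - P x) = 0" by (simp add: blinfun.diff_right PP)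
  also have "cinner x 0 = 0" using cinner_add_right[of x 0 0] by simp
  finally have "(norm (P x + (x - P x)))\<^sup>2 = (norm (P x))\<^sup>2 + (norm (x - P x))\<^sup>2"
    by (rule norm_add_orthogonal)
  then have "(norm (P x))\<^sup>2 \<le> (norm x)\<^sup>2" by simp
  then show ?thesis by (simp add: power2_le_iff_abs_le)
qed

section \<open>The norm estimate and continuity\<close>

locale ample_groupoid_representation = hausdorff_ample_groupoid G
  for G :: "'g groupoid_data" +
  fixes \<pi> :: "('g \<Rightarrow> complex) \<Rightarrow> 'h::complex_hilbert \<Rightarrow>\<^sub>L 'h"
  assumes star_hom: "star_homomorphism G \<pi>"
begin

lemma
  assumes "f \<in> steinberg_algebra G" "g \<in> steinberg_algebra G"
  shows \<pi>_add: "\<pi> (\<lambda>\<gamma>. f \<gamma> + g \<gamma>) = \<pi> f + \<pi> g"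
    and \<pi>_mult: "\<pi> (convolution G f g) = \<pi> f o\<^sub>L \<pi> g"
  using assms star_hom by (auto simp: star_homomorphism_def)

lemma
  assumes "f \<in> steinberg_algebra G"
  shows \<pi>_scale: "\<pi> (\<lambda>\<gamma>. c * f \<gamma>) x = c *\<^sub>C \<pi> f x"
    and \<pi>_star: "is_adjoint (\<pi> (involution G f)) (\<pi> f)"
  using assms star_hom by (auto simp: star_homomorphism_def)

lemma \<pi>_zero: "\<pi> (\<lambda>_. 0) = 0"
  using \<pi>_add[OF steinberg_zero steinberg_zero] by simp

lemma \<pi>_sum:
  assumes "finite J" "\<And>j. j \<in> J \<Longrightarrow> f j \<in> steinberg_algebra G"
  shows "\<pi> (\<lambda>\<gamma>. \<Sum>j\<in>J. f j \<gamma>) = (\<Sum>j\<in>J. \<pi> (f j))"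
  using assms
proof (induction J rule: finite_induct)
  case empty show ?case by (simp add: \<pi>_zero)
next
  case (insert i J)
  then show ?case by (simp add: \<pi>_add steinberg_sum)
qed

lemma \<pi>_diff:
  assumes "f \<in> steinberg_algebra G" "g \<in> steinberg_algebra G"
  shows "\<pi> (\<lambda>\<gamma>. f \<gamma> - g \<gamma>) = \<pi> f - \<pi> g"
proof -
  have "(\<lambda>\<gamma>. f \<gamma> - g \<gamma>) \<in> steinberg_algebra G"
    using steinberg_add[OF assms(1) steinberg_scale[OF assms(2), of "-1"]] by simp
  from \<pi>_add[OF this assms(2)] show ?thesis by (simp add: algebra_simps)
qed

lemma cinner_\<pi>:
  assumes "cob V" "g \<in> steinberg_algebra G"
  shows "cinner (\<pi> (indicator V) x) (\<pi> g y) = cinner x (\<pi> (convolution G (involution G (indicator V)) g) y)"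
proof -
  have "involution G (indicator V) \<in> steinberg_algebra G"
    using assms(1) by (simp add: involution_indicator cob_subset cob_inv steinberg_indicator)
  from \<pi>_mult[OF this assms(2)] \<pi>_star[OF steinberg_indicator[OF assms(1)]] show ?thesis
    by (simp add: is_adjoint_def)
qed

text \<open>
  Disjoint subsets of a bisection have disjoint ranges, so that \<open>1\<^sub>V\<^sup>* * g = 0\<close>.
\<close>

lemma \<pi>_orthogonal:
  assumes "cob B" "cob V" "V \<subseteq> B" "D \<subseteq> B" "V \<inter> D = {}"
    and "g \<in> steinberg_algebra G" "\<And>\<gamma>. \<gamma> \<notin> D \<Longrightarrow> g \<gamma> = 0"
  shows "cinner (\<pi> (indicator V) x) (\<pi> g y) = 0"
proof -
  have "convolution G (involution G (indicator V)) g = (\<lambda>_. 0)"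
    using convolution_involution_disjoint[OF cob_subset[OF assms(2)] cob_disjoint_rng[OF assms(1,3,4,5)]] assms(7)
    by blast
  moreover have "cinner x 0 = 0" using cinner_add_right[of x 0 0] by simp
  ultimately show ?thesis
    using cinner_\<pi>[OF assms(2,6)] by (simp add: \<pi>_zero)
qed

text \<open>
  With \<open>P\<close> the image of the indicator of the source of \<open>V\<close>, a projection, one has
  \<open>\<pi> 1\<^sub>V\<^sup>* \<pi> 1\<^sub>V = P\<close>, and hence \<open>\<pi> 1\<^sub>V x\<close> and \<open>P x\<close> have the same norm.
\<close>

lemma \<pi>_indicator_contraction:
  assumes "cob V" shows "norm (\<pi> (indicator V) x) \<le> norm x"
proof -
  let ?S = "src G ` V"
  let ?P = "\<pi> (indicator ?S)"
  have S: "cob ?S" "?S \<subseteq> units G" using cob_src_image[OF assms] cob_subset[OF assms] src_in_units by auto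
  have "ginv G ` ?S = ?S"
    using S(2) inv_unit by (force simp: image_iff subset_iff)
  then have "involution G (indicator ?S) = indicator ?S"
    using involution_indicator[OF cob_subset[OF S(1)]] by simp
  then have adj: "is_adjoint ?P ?P"
    using \<pi>_star[OF steinberg_indicator[OF S(1)]] by simp
  have "convolution G (indicator ?S) (indicator ?S) = indicator ?S"
    using S convolution_indicator[of ?S ?S] by (simp add: arrow_prod_units cob_iff)
  then have idem: "?P o\<^sub>L ?P = ?P"
    using \<pi>_mult[OF steinberg_indicator[OF S(1)] steinberg_indicator[OF S(1)]] by simp
  have "convolution G (involution G (indicator V)) (indicator V) = indicator ?S"
    using assms convolution_indicator[of "ginv G ` V" V] cob_inv[OF assms]
    by (simp add: involution_indicator cob_subset arrow_prod_inv_self cob_iff)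
  then have "cinner (\<pi> (indicator V) x) (\<pi> (indicator V) x) = cinner x (?P x)"
    using cinner_\<pi>[OF assms steinberg_indicator[OF assms]] by simp
  also have "\<dots> = cinner x (?P (?P x))" using idem by (metis blinfun_apply_blinfun_compose)
  also have "\<dots> = cinner (?P x) (?P x)" using adj by (simp add: is_adjoint_def)
  finally have "norm (\<pi> (indicator V) x) = norm (?P x)"
    unfolding cinner_self of_real_eq_iff by (simp add: power2_eq_iff_nonneg)
  then show ?thesis using projection_contraction[OF adj idem] by simp
qed

text \<open>
  A plain bound by \<open>M * norm x\<close> would not survive the induction, since adding the pieces would add
  the bounds. Comparing with the vector \<open>\<pi> 1\<^sub>D x\<close> works instead, because the squared norms on
  both sides are additive over the orthogonal pieces.
\<close>

lemma norm_\<pi>_step_le: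
  assumes "step_on B M D g" "cob B" 
  shows "(norm (\<pi> g x))\<^sup>2 \<le> M\<^sup>2 * (norm (\<pi> (indicator D) x))\<^sup>2"
  using assms
proof (induction rule: step_on.induct)
  case zero show ?case by (simp add: \<pi>_zero)
next
  case (piece D g V a)
  note V = \<open>cob V\<close>
  have D: "D \<subseteq> B" "cob D" "g \<in> steinberg_algebra G"
    using step_on_subset step_on_cob step_on_steinberg piece.hyps(1) piece.prems by metis+
  note orth = \<pi>_orthogonal[OF piece.prems V piece.hyps(3) D(1) piece.hyps(4)]
  have mem: "indicator V \<in> steinberg_algebra G" "(\<lambda>\<gamma>. a * indicator V \<gamma>) \<in> steinberg_algebra G"
    "indicator D \<in> steinberg_algebra G"
    using V D steinberg_indicator steinberg_scale by blast+
  have "indicator (V \<union> D) = (\<lambda>\<gamma>. indicator V \<gamma> + indicator D \<gamma> :: complex)"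
    using piece.hyps(4) by (auto simp: fun_eq_iff indicator_def)
  then have "\<pi> (indicator (V \<union> D)) x = \<pi> (indicator V) x + \<pi> (indicator D) x"
    using \<pi>_add[OF mem(1,3)] by (simp add: blinfun.add_left)
  then have VD: "(norm (\<pi> (indicator (V \<union> D)) x))\<^sup>2 =
      (norm (\<pi> (indicator V) x))\<^sup>2 + (norm (\<pi> (indicator D) x))\<^sup>2"
    using norm_add_orthogonal[OF orth[OF mem(3)]] by simp
  have "\<pi> (\<lambda>\<gamma>. a * indicator V \<gamma> + g \<gamma>) x = a *\<^sub>C \<pi> (indicator V) x + \<pi> g x"
    using \<pi>_add[OF mem(2) D(3)] \<pi>_scale[OF mem(1)] by (simp add: blinfun.add_left)
  moreover have "cinner (a *\<^sub>C \<pi> (indicator V) x) (\<pi> g x) = 0"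
    using orth[OF D(3)] step_on_vanishes[OF piece.hyps(1)] by (simp add: cinner_scaleC_left)
  ultimately have "(norm (\<pi> (\<lambda>\<gamma>. a * indicator V \<gamma> + g \<gamma>) x))\<^sup>2 =
      (cmod a)\<^sup>2 * (norm (\<pi> (indicator V) x))\<^sup>2 + (norm (\<pi> g x))\<^sup>2"
    using norm_add_orthogonal[of "a *\<^sub>C \<pi> (indicator V) x" "\<pi> g x"]
    by (simp add: norm_scaleC power_mult_distrib)
  also have "\<dots> \<le> M\<^sup>2 * (norm (\<pi> (indicator V) x))\<^sup>2 + M\<^sup>2 * (norm (\<pi> (indicator D) x))\<^sup>2"
    using piece.IH[OF piece.prems] piece.hyps(5) by (intro add_mono mult_right_mono power_mono) auto
  also have "\<dots> = M\<^sup>2 * (norm (\<pi> (indicator (V \<union> D)) x))\<^sup>2"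
    by (simp add: VD distrib_left)
  finally show ?case .
qed

lemma norm_\<pi>_step:
  assumes "step_on B M D g" "cob B" "0 \<le> M"
  shows "norm (\<pi> g) \<le> M"
proof (rule norm_blinfun_bound)
  fix x
  have "(norm (\<pi> g x))\<^sup>2 \<le> M\<^sup>2 * (norm (\<pi> (indicator D) x))\<^sup>2"
    by (rule norm_\<pi>_step_le[OF assms(1,2)])
  also have "\<dots> \<le> M\<^sup>2 * (norm x)\<^sup>2"
    using \<pi>_indicator_contraction[OF step_on_cob[OF assms(1,2)]] by (intro mult_left_mono power_mono) auto
  finally have "(norm (\<pi> g x))\<^sup>2 \<le> (M * norm x)\<^sup>2" by (simp add: power_mult_distrib)
  then show "norm (\<pi> g x) \<le> M * norm x" by (rule power2_le_imp_le) (simp add: assms(3))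
qed (rule assms(3))

text \<open>
  The quantitative form of the continuity: the constant depends only on a family of bisections
  covering the support.
\<close>

lemma norm_\<pi>_le:
  assumes f: "f \<in> steinberg_algebra G"
    and \<J>: "finite \<J>" "\<And>J. J \<in> \<J> \<Longrightarrow> cob J" "osupp G f \<subseteq> \<Union>\<J>"
    and M: "0 \<le> M" "\<And>\<gamma>. \<gamma> \<in> arrows G \<Longrightarrow> cmod (f \<gamma>) \<le> M"
  shows "norm (\<pi> f) \<le> real (card \<J>) * M"
proof -
  obtain g D where gD: "\<And>J. J \<in> \<J> \<Longrightarrow> step_on J M (D J) (g J)" "f = (\<lambda>\<gamma>. \<Sum>J\<in>\<J>. g J \<gamma>)"
    using decomposition[OF f \<J> M(2)] by blast
  then have "\<pi> f = (\<Sum>J\<in>\<J>. \<pi> (g J))"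
    using \<pi>_sum[OF \<J>(1)] step_on_steinberg by blast
  also have "norm \<dots> \<le> real (card \<J>) * M"
    by (rule sum_norm_bound) (use norm_\<pi>_step gD(1) \<J>(2) M(1) in blast)
  finally show ?thesis .
qed

lemma compact_cover:
  assumes "compactin (arrow_top G) K"
  shows "\<exists>\<J>. finite \<J> \<and> (\<forall>J\<in>\<J>. cob J) \<and> K \<subseteq> \<Union>\<J>"
proof -
  have "K \<subseteq> \<Union>{J. cob J}"
    using compactin_subset_topspace[OF assms] compact_open_bisection_basis[OF openin_topspace] by blast
  moreover have "\<forall>J\<in>{J. cob J}. openin (arrow_top G) J" by (simp add: cob_iff)
  ultimately obtain \<J> where "finite \<J>" "\<J> \<subseteq> {J. cob J}" "K \<subseteq> \<Union>\<J>"
    using assms unfolding compactin_def by meson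
  then show ?thesis by blast
qed

lemma \<pi>_tendsto:
  assumes f: "\<forall>\<^sub>F i in F. f i \<in> steinberg_algebra G"
    and l: "l \<in> steinberg_algebra G"
    and lim: "tendsto_ind_limit G f l F"
  shows "((\<lambda>i. \<pi> (f i)) \<longlongrightarrow> \<pi> l) F"
proof -
  obtain K where K: "compactin (arrow_top G) K" "\<forall>\<^sub>F i in F. osupp G (f i) \<subseteq> K"
    and unif: "uniform_limit (arrows G) f l F"
    using lim by (auto simp: tendsto_ind_limit_def)
  obtain \<J> where \<J>: "finite \<J>" "\<forall>J\<in>\<J>. cob J" "K \<subseteq> \<Union>\<J>"
    using compact_cover[OF K(1)] by blast
  obtain \<B> c where \<B>: "finite \<B>" "\<forall>B\<in>\<B>. cob B"
      and l_eq: "l = (\<lambda>\<gamma>. \<Sum>B\<in>\<B>. c B * indicator B \<gamma>)"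
    using l by (auto simp: steinberg_algebra_iff)
  have osupp_l: "osupp G l \<subseteq> \<Union>\<B>"
  proof
    fix \<gamma> assume "\<gamma> \<in> osupp G l"
    then have "l \<gamma> \<noteq> 0" by (simp add: osupp_def)
    then obtain B where "B \<in> \<B>" "c B * indicator B \<gamma> \<noteq> 0"
      unfolding l_eq by (meson sum.neutral)
    then show "\<gamma> \<in> \<Union>\<B>" by (auto simp: indicator_def split: if_splits)
  qed
  define n where "n = card (\<J> \<union> \<B>)"
  have "\<forall>\<^sub>F i in F. dist (\<pi> (f i)) (\<pi> l) < e" if e: "e > 0" for e
  proof -
    \<comment> \<open>Dividing by \<open>n + 1\<close> makes \<open>n * M\<close> strictly less than \<open>e\<close>, also for \<open>n = 0\<close>.\<close>
    define M where "M = e / (real n + 1)"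
    have M: "0 < M" "real n * M < e"
      using e by (auto simp: M_def field_simps)
    have "\<forall>\<^sub>F i in F. \<forall>\<gamma>\<in>arrows G. dist (f i \<gamma>) (l \<gamma>) < M"
      using unif M(1) by (rule uniform_limitD)
    with f K(2) show ?thesis
    proof eventually_elim
      case (elim i)
      have "(\<lambda>\<gamma>. f i \<gamma> - l \<gamma>) \<in> steinberg_algebra G"
        using steinberg_add[OF elim(1) steinberg_scale[OF l, of "-1"]] by simp
      moreover have "osupp G (\<lambda>\<gamma>. f i \<gamma> - l \<gamma>) \<subseteq> \<Union>(\<J> \<union> \<B>)"
        using elim(2) \<J>(3) osupp_l by (fastforce simp: osupp_def)
      ultimately have "norm (\<pi> (\<lambda>\<gamma>. f i \<gamma> - l \<gamma>)) \<le> real n * M"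
        unfolding n_def using \<J> \<B> M(1) elim(3)
        by (intro norm_\<pi>_le) (auto simp: dist_norm less_imp_le)
      then show ?case
        using \<pi>_diff[OF elim(1) l] M(2) by (simp add: dist_norm)
    qed
  qed
  then show ?thesis by (rule tendstoI)
qed

end

theorem proposition5p2:
  fixes G :: "'g groupoid_data"
    and \<pi> :: "('g \<Rightarrow> complex) \<Rightarrow> ('h::complex_hilbert \<Rightarrow>\<^sub>L 'h)"
  assumes "ample_groupoid G"
    and "Hausdorff_space (unit_top G)"
    and "star_homomorphism G \<pi>"
  shows "\<forall>(F :: 'i filter) f l.
           (\<forall>\<^sub>F i in F. f i \<in> steinberg_algebra G) \<and> l \<in> steinberg_algebra G \<and>
           tendsto_ind_limit G f l F \<longrightarrow>
           ((\<lambda>i. \<pi> (f i)) \<longlongrightarrow> \<pi> l) F"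
proof -
  interpret topological_groupoid G
    using assms(1) by (simp add: ample_groupoid_def etale_groupoid_def)
  interpret ample_groupoid_representation G \<pi>
    using assms by unfold_locales (auto simp: ample_groupoid_def etale_groupoid_def)
  show ?thesis using \<pi>_tendsto by blast
qed

end
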